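(* Let $\mathcal{S}$ be a thick generalized quadrangle, and let $\mathcal{S}'$ be a thick full subquadrangle of $\mathcal{S}$ which is a geometrical hyperplane of $\mathcal{S}$. Let $\mathcal{A}$ be the affine quadrangle $\mathcal{S}\setminus\mathcal{S}'$, $\mathcal{E}$ the geometry of subtended ovoids and rosettes of $\mathcal{S}'$, and $\pi:\mathcal{A}\mapsto\mathcal{E}$ the natural projection. Let $\mathtt{Co}(\mathcal{A},\mathcal{E})$ be the category whose objects are the covers $\kappa:\mathcal{A}\mapsto\mathcal{E}$, and in which the morphisms from $\kappa':\mathcal{A}\mapsto\mathcal{E}$ to $\kappa'':\mathcal{A}\mapsto\mathcal{E}$ are the morphisms of geometries $\vartheta:\mathcal{E}\mapsto\mathcal{E}$ with $\vartheta\circ\kappa'=\kappa''$. Then $\pi:\mathcal{A}\mapsto\mathcal{E}$ is an initial object of $\mathtt{Co}(\mathcal{A},\mathcal{E})$. It follows that each object of $\mathtt{Co}(\mathcal{A},\mathcal{E})$ is a zero object (that is, both initial and terminal).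
   Context: A generalized quadrangle (GQ) of order $(s,t)$ ($s,t$ cardinal numbers, possibly infinite) is a point-line incidence geometry in which each point is incident with $t+1$ lines, each line with $s+1$ points, two distinct points are incident with at most one line, and for each non-incident point-line pair $(x,L)$ there is exactly one point-line pair $(y,M)$ with $x\,\mathbf{I}\,M\,\mathbf{I}\,y\,\mathbf{I}\,L$. It is thick if $s,t\ge 2$. Write $x\sim y$ if the points $x,y$ are collinear (every point is collinear with itself), and $x^\perp=\{z: z\sim x\}$. A subquadrangle $\mathcal{S}'$ of $\mathcal{S}$ is full if every point of $\mathcal{S}$ on a line of $\mathcal{S}'$ is a point of $\mathcal{S}'$. It is a geometrical hyperplane if every line of $\mathcal{S}$ either is a line of $\mathcal{S}'$ (with all its points in $\mathcal{S}'$) or contains exactly one point of $\mathcal{S}'$. The geometry $\mathcal{A}$ consists of the points and lines of $\mathcal{S}$ not in $\mathcal{S}'$, with the induced incidence. For a point $x$ of $\mathcal{S}\setminus\mathcal{S}'$, $\mathcal{O}_x:=x^\perp\cap\mathcal{S}'$ is an ovoid of $\mathcal{S}'$ (a point set meeting each line in exactly one point), called the ovoid subtended by $x$. For a line $L$ of $\mathcal{S}$ not in $\mathcal{S}'$, meeting $\mathcal{S}'$ in the point $\ell$, the rosette $R_L$ is the set of all $\mathcal{O}_x$ with $x$ on $L$, $x\ne\ell$. The geometry $\mathcal{E}$ has as points the subtended ovoids of $\mathcal{S}'$, as lines the rosettes $R_L$, and incidence is containment. The natural projection $\pi:\mathcal{A}\mapsto\mathcal{E}$ sends each point $x$ to $\mathcal{O}_x$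 and each line $L$ to $R_L$. A morphism of point-line geometries maps points to points, lines to lines, and preserves incidence. A cover $\gamma:\Gamma\mapsto\Gamma'$ (with $\Gamma$ nonempty) is a morphism which is locally bijective: for each point $x$ of $\Gamma$ it induces a bijection between the lines on $x$ and the lines on $\gamma(x)$, and for each line $L$ of $\Gamma$ a bijection between the points on $L$ and the points on $\gamma(L)$.
   Formalization: It is assumed in addition that the natural projection π is a cover, i.e. an object of Co(A,E); this does not follow from the other hypotheses: it fails for T_2(O) in T_3(Ω), Ω the Suzuki–Tits ovoid of PG(3,8) and O a plane section, and when S' = S. *)

theory Defs
  imports Main "HOL-Library.FuncSet"
begin

unbundle cardinal_syntax

section \<open>Point-line geometries\<close>

text \<open>
  The value of \<^term>\<open>Inc\<close> outside the carriers is irrelevant: incidence is only ever used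
  between members of \<^term>\<open>Pts\<close> and \<^term>\<open>Lns\<close>.
\<close>

record ('p, 'l) geometry =
  Pts :: "'p set"
  Lns :: "'l set"
  Inc :: "'p \<Rightarrow> 'l \<Rightarrow> bool"

definition lines_on :: "('p, 'l) geometry \<Rightarrow> 'p \<Rightarrow> 'l set" where
  "lines_on G x = {L \<in> Lns G. Inc G x L}"

definition points_on :: "('p, 'l) geometry \<Rightarrow> 'l \<Rightarrow> 'p set" where
  "points_on G L = {x \<in> Pts G. Inc G x L}"

section \<open>Generalized quadrangles\<close>

text \<open>
  The parameters of the order are cardinals (possibly infinite), represented by cardinal orders.
\<close>

definition gen_quadrangle :: "('p, 'l) geometry \<Rightarrow> 'c rel \<Rightarrow> 'd rel \<Rightarrow> bool" where
  "gen_quadrangle S s t \<longleftrightarrow>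
     Card_order s \<and> Card_order t \<and>
     (\<forall>x \<in> Pts S. |lines_on S x| =o t +c cone) \<and>
     (\<forall>L \<in> Lns S. |points_on S L| =o s +c cone) \<and>
     (\<forall>x \<in> Pts S. \<forall>y \<in> Pts S. x \<noteq> y \<longrightarrow>
        (\<forall>L \<in> lines_on S x \<inter> lines_on S y. \<forall>M \<in> lines_on S x \<inter> lines_on S y. L = M)) \<and>
     (\<forall>x \<in> Pts S. \<forall>L \<in> Lns S. \<not> Inc S x L \<longrightarrow>
        (\<exists>!yM. case yM of (y, M) \<Rightarrow>
           y \<in> Pts S \<and> M \<in> Lns S \<and> Inc S x M \<and> Inc S y M \<and> Inc S y L))"

definition thick_gen_quadrangle :: "('p, 'l) geometry \<Rightarrow> 'c rel \<Rightarrow> 'd rel \<Rightarrow> bool" where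
  "thick_gen_quadrangle S s t \<longleftrightarrow> gen_quadrangle S s t \<and> ctwo \<le>o s \<and> ctwo \<le>o t"

definition collinear :: "('p, 'l) geometry \<Rightarrow> 'p \<Rightarrow> 'p \<Rightarrow> bool" where
  "collinear S x y \<longleftrightarrow> x = y \<or> (\<exists>L \<in> Lns S. Inc S x L \<and> Inc S y L)"

definition perp :: "('p, 'l) geometry \<Rightarrow> 'p \<Rightarrow> 'p set" where
  "perp S x = {z \<in> Pts S. collinear S z x}"

definition subgeometry :: "('p, 'l) geometry \<Rightarrow> ('p, 'l) geometry \<Rightarrow> bool" where
  "subgeometry S' S \<longleftrightarrow>
     Pts S' \<subseteq> Pts S \<and> Lns S' \<subseteq> Lns S \<and>
     (\<forall>x \<in> Pts S'. \<forall>L \<in> Lns S'. Inc S' x L \<longleftrightarrow> Inc S x L)"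

definition full_in :: "('p, 'l) geometry \<Rightarrow> ('p, 'l) geometry \<Rightarrow> bool" where
  "full_in S' S \<longleftrightarrow> (\<forall>L \<in> Lns S'. points_on S L \<subseteq> Pts S')"

definition geometrical_hyperplane :: "('p, 'l) geometry \<Rightarrow> ('p, 'l) geometry \<Rightarrow> bool" where
  "geometrical_hyperplane S' S \<longleftrightarrow>
     (\<forall>L \<in> Lns S. (L \<in> Lns S' \<and> points_on S L \<subseteq> Pts S') \<or>
                  (\<exists>!x. x \<in> points_on S L \<and> x \<in> Pts S'))"

section \<open>The affine quadrangle, subtended ovoids and rosettes\<close>

definition affine_quadrangle ::
    "('p, 'l) geometry \<Rightarrow> ('p, 'l) geometry \<Rightarrow> ('p, 'l) geometry" where
  "affine_quadrangle S S' = \<lparr>Pts = Pts S - Pts S', Lns = Lns S - Lns S', Inc = Inc S\<rparr>"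

definition subtended_ovoid ::
    "('p, 'l) geometry \<Rightarrow> ('p, 'l) geometry \<Rightarrow> 'p \<Rightarrow> 'p set" where
  "subtended_ovoid S S' x = perp S x \<inter> Pts S'"

text \<open>
  For a line \<open>L\<close> outside the hyperplane \<open>S'\<close>, the points of \<open>L\<close> other than its unique point
  in \<open>S'\<close> are exactly its points in the affine quadrangle.
\<close>

definition rosette ::
    "('p, 'l) geometry \<Rightarrow> ('p, 'l) geometry \<Rightarrow> 'l \<Rightarrow> 'p set set" where
  "rosette S S' L = subtended_ovoid S S' ` points_on (affine_quadrangle S S') L"

definition ovoid_geometry ::
    "('p, 'l) geometry \<Rightarrow> ('p, 'l) geometry \<Rightarrow> ('p set, 'p set set) geometry" where
  "ovoid_geometry S S' =
     \<lparr>Pts = subtended_ovoid S S' ` Pts (affine_quadrangle S S'),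
      Lns = rosette S S' ` Lns (affine_quadrangle S S'),
      Inc = (\<lambda>Ov R. Ov \<in> R)\<rparr>"

section \<open>Morphisms and covers\<close>

text \<open>
  A morphism is a pair consisting of its point map and its line map. Both maps are required to be
  extensional (undefined outside the carriers), so that equality of pairs is equality of morphisms.
\<close>

type_synonym ('p, 'l, 'q, 'm) geom_map = "('p \<Rightarrow> 'q) \<times> ('l \<Rightarrow> 'm)"

definition geom_morphisms ::
    "('p, 'l) geometry \<Rightarrow> ('q, 'm) geometry \<Rightarrow> ('p, 'l, 'q, 'm) geom_map set" where
  "geom_morphisms G H =
     {(f, g). f \<in> Pts G \<rightarrow>\<^sub>E Pts H \<and> g \<in> Lns G \<rightarrow>\<^sub>E Lns H \<and>
        (\<forall>x \<in> Pts G. \<forall>L \<in> Lns G. Inc G x L \<longrightarrow> Inc H (f x) (g L))}"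

definition id_morphism :: "('p, 'l) geometry \<Rightarrow> ('p, 'l, 'p, 'l) geom_map" where
  "id_morphism G = (restrict id (Pts G), restrict id (Lns G))"

text \<open>The composite (second map after first map), where the first map starts from \<open>G\<close>.\<close>

definition comp_morphism ::
    "('p, 'l) geometry \<Rightarrow> ('q, 'm, 'r, 'n) geom_map \<Rightarrow> ('p, 'l, 'q, 'm) geom_map \<Rightarrow>
     ('p, 'l, 'r, 'n) geom_map" where
  "comp_morphism G \<psi> \<phi> =
     (compose (Pts G) (fst \<psi>) (fst \<phi>), compose (Lns G) (snd \<psi>) (snd \<phi>))"

definition is_cover ::
    "('p, 'l) geometry \<Rightarrow> ('q, 'm) geometry \<Rightarrow> ('p, 'l, 'q, 'm) geom_map \<Rightarrow> bool" where
  "is_cover G H \<gamma> \<longleftrightarrow>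
     \<not> (Pts G = {} \<and> Lns G = {}) \<and> \<gamma> \<in> geom_morphisms G H \<and>
     (\<forall>x \<in> Pts G. bij_betw (snd \<gamma>) (lines_on G x) (lines_on H (fst \<gamma> x))) \<and>
     (\<forall>L \<in> Lns G. bij_betw (fst \<gamma>) (points_on G L) (points_on H (snd \<gamma> L)))"

text \<open>
  The natural projection is bijective on the points of each line, but it need not be a cover:
  if \<open>x\<close> and \<open>y\<close> subtend the same ovoid, the rosettes of lines on \<open>y\<close> need not be rosettes of
  lines on \<open>x\<close>. This happens for \<open>T\<^sub>2(O) \<subset> T\<^sub>3(\<Omega>)\<close> with \<open>\<Omega>\<close> a Suzuki--Tits ovoid
  of \<open>PG(3,8)\<close> and \<open>O\<close> a plane section of \<open>\<Omega>\<close>.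
\<close>

definition natural_projection ::
    "('p, 'l) geometry \<Rightarrow> ('p, 'l) geometry \<Rightarrow> ('p, 'l, 'p set, 'p set set) geom_map" where
  "natural_projection S S' =
     (restrict (subtended_ovoid S S') (Pts (affine_quadrangle S S')),
      restrict (rosette S S') (Lns (affine_quadrangle S S')))"

section \<open>Categories\<close>

record ('o, 'a) category =
  Ob :: "'o set"
  Hom :: "'o \<Rightarrow> 'o \<Rightarrow> 'a set"
  Idn :: "'o \<Rightarrow> 'a"
  Comp :: "'a \<Rightarrow> 'a \<Rightarrow> 'a"

definition is_category :: "('o, 'a) category \<Rightarrow> bool" where
  "is_category C \<longleftrightarrow>
     (\<forall>a \<in> Ob C. Idn C a \<in> Hom C a a) \<and>
     (\<forall>a \<in> Ob C. \<forall>b \<in> Ob C. \<forall>c \<in> Ob C. \<forall>f \<in> Hom C a b. \<forall>g \<in> Hom C b c.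
        Comp C g f \<in> Hom C a c) \<and>
     (\<forall>a \<in> Ob C. \<forall>b \<in> Ob C. \<forall>f \<in> Hom C a b.
        Comp C f (Idn C a) = f \<and> Comp C (Idn C b) f = f) \<and>
     (\<forall>a \<in> Ob C. \<forall>b \<in> Ob C. \<forall>c \<in> Ob C. \<forall>d \<in> Ob C.
        \<forall>f \<in> Hom C a b. \<forall>g \<in> Hom C b c. \<forall>h \<in> Hom C c d.
        Comp C h (Comp C g f) = Comp C (Comp C h g) f)"

definition initial_object :: "('o, 'a) category \<Rightarrow> 'o \<Rightarrow> bool" where
  "initial_object C a \<longleftrightarrow> a \<in> Ob C \<and> (\<forall>b \<in> Ob C. \<exists>!f. f \<in> Hom C a b)"

definition terminal_object :: "('o, 'a) category \<Rightarrow> 'o \<Rightarrow> bool" where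
  "terminal_object C a \<longleftrightarrow> a \<in> Ob C \<and> (\<forall>b \<in> Ob C. \<exists>!f. f \<in> Hom C b a)"

definition zero_object :: "('o, 'a) category \<Rightarrow> 'o \<Rightarrow> bool" where
  "zero_object C a \<longleftrightarrow> initial_object C a \<and> terminal_object C a"

definition cover_category ::
    "('p, 'l) geometry \<Rightarrow> ('q, 'm) geometry \<Rightarrow>
     (('p, 'l, 'q, 'm) geom_map, ('q, 'm, 'q, 'm) geom_map) category" where
  "cover_category A E =
     \<lparr>Ob = {\<kappa>. is_cover A E \<kappa>},
      Hom = (\<lambda>\<kappa>' \<kappa>''. {\<theta> \<in> geom_morphisms E E. comp_morphism A \<theta> \<kappa>' = \<kappa>''}),
      Idn = (\<lambda>\<kappa>. id_morphism E),
      Comp = comp_morphism E\<rparr>"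

lemma comp_morphism_in:
  assumes "\<phi> \<in> geom_morphisms G H" "\<psi> \<in> geom_morphisms H K"
  shows "comp_morphism G \<psi> \<phi> \<in> geom_morphisms G K"
  using assms unfolding geom_morphisms_def comp_morphism_def
  by (fastforce simp: compose_def PiE_iff)

lemma comp_morphism_assoc:
  assumes "\<phi> \<in> geom_morphisms G H"
  shows "comp_morphism G \<chi> (comp_morphism G \<psi> \<phi>) = comp_morphism G (comp_morphism H \<chi> \<psi>) \<phi>"
  using assms unfolding geom_morphisms_def comp_morphism_def
  by (auto simp: compose_def PiE_iff fun_eq_iff)

lemma comp_morphism_id_left:
  assumes "\<phi> \<in> geom_morphisms G H"
  shows "comp_morphism G (id_morphism H) \<phi> = \<phi>"
  using assms unfolding geom_morphisms_def comp_morphism_def id_morphism_def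
  by (auto simp: compose_def PiE_iff fun_eq_iff extensional_def) metis+

lemma comp_morphism_id_right:
  assumes "\<phi> \<in> geom_morphisms G H"
  shows "comp_morphism G \<phi> (id_morphism G) = \<phi>"
  using assms unfolding geom_morphisms_def comp_morphism_def id_morphism_def
  by (auto simp: compose_def PiE_iff fun_eq_iff extensional_def)

lemma id_morphism_in: "id_morphism G \<in> geom_morphisms G G"
  unfolding geom_morphisms_def id_morphism_def by auto

lemma is_category_cover_category: "is_category (cover_category A E)"
proof -
  have cov: "\<kappa> \<in> geom_morphisms A E" if "is_cover A E \<kappa>" for \<kappa>
    using that by (simp add: is_cover_def)
  have hom: "\<theta> \<in> geom_morphisms E E"
    if "\<theta> \<in> Hom (cover_category A E) a b" for \<theta> a b
    using that by (simp add: cover_category_def)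
  have idn: "Idn (cover_category A E) a \<in> Hom (cover_category A E) a a"
    if "a \<in> Ob (cover_category A E)" for a
    using that by (simp add: cover_category_def id_morphism_in comp_morphism_id_left[OF cov])
  have comp: "Comp (cover_category A E) g f \<in> Hom (cover_category A E) a c"
    if "a \<in> Ob (cover_category A E)" "f \<in> Hom (cover_category A E) a b"
      "g \<in> Hom (cover_category A E) b c" for a b c f g
    using that comp_morphism_in[OF hom hom, of f a b g b c]
    by (auto simp: cover_category_def comp_morphism_assoc[OF cov, symmetric])
  have unit: "Comp (cover_category A E) f (Idn (cover_category A E) a) = f \<and>
      Comp (cover_category A E) (Idn (cover_category A E) b) f = f"
    if "f \<in> Hom (cover_category A E) a b" for a b f
    using comp_morphism_id_left[OF hom[OF that]] comp_morphism_id_right[OF hom[OF that]]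
    by (simp add: cover_category_def)
  have assoc: "Comp (cover_category A E) h (Comp (cover_category A E) g f) =
      Comp (cover_category A E) (Comp (cover_category A E) h g) f"
    if "f \<in> Hom (cover_category A E) a b" for a b f g h
    using comp_morphism_assoc[OF hom[OF that]] by (simp add: cover_category_def)
  show ?thesis
    unfolding is_category_def using idn comp unit assoc by blast
qed

end

theory Submission
  imports Defs
begin

text \<open>
  Two distinct points of the affine quadrangle subtend the same ovoid exactly if no path of at most
  two lines joins them. Hence any two points of \<open>E\<close> are joined by such a path, and \<open>E\<close> is a
  partial linear space because \<open>\<pi>\<close> is a cover. For an arbitrary cover \<open>\<kappa>\<close>, local bijectivity
  then shows that distinct points with the same image are not joined by such a path, so that
  they subtend the same ovoid. Conversely, if \<open>x\<close> and \<open>y\<close> subtend the same ovoid, then a path in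
  \<open>E\<close> from \<open>\<kappa> x\<close> to \<open>\<kappa> y\<close> lifts to a path in \<open>A\<close> from \<open>x\<close> to some \<open>y'\<close> with \<open>\<kappa> y' = \<kappa> y\<close>,
  so \<open>x\<close> and \<open>y'\<close> subtend the same ovoid and \<open>x = y'\<close>. Thus all covers have the same fibres.
\<close>

text \<open>Degenerate paths count: \<open>L = M\<close> and \<open>z\<close> equal to an end are
  allowed, so collinear points on a common line are also joined.\<close>

definition two_path :: "('p, 'l) geometry \<Rightarrow> 'p \<Rightarrow> 'p \<Rightarrow> bool" where
  "two_path G x y \<longleftrightarrow> (\<exists>L \<in> Lns G. \<exists>M \<in> Lns G. \<exists>z \<in> Pts G.
     x \<in> Pts G \<and> y \<in> Pts G \<and> Inc G x L \<and> Inc G z L \<and> Inc G z M \<and> Inc G y M)"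

definition partial_linear :: "('p, 'l) geometry \<Rightarrow> bool" where
  "partial_linear G \<longleftrightarrow> (\<forall>x \<in> Pts G. \<forall>y \<in> Pts G. \<forall>L \<in> Lns G. \<forall>M \<in> Lns G.
     Inc G x L \<and> Inc G y L \<and> Inc G x M \<and> Inc G y M \<longrightarrow> x = y \<or> L = M)"

lemma partial_linearD:
  assumes "partial_linear G" "x \<in> Pts G" "y \<in> Pts G" "L \<in> Lns G" "M \<in> Lns G"
    "Inc G x L" "Inc G y L" "Inc G x M" "Inc G y M" "x \<noteq> y"
  shows "L = M"
  using assms unfolding partial_linear_def by blast

section \<open>Covers\<close>

context
  fixes G :: "('p, 'l) geometry" and H :: "('q, 'm) geometry" and \<gamma>
  assumes cover: "is_cover G H \<gamma>"
begin

lemma cover_point: "x \<in> Pts G \<Longrightarrow> fst \<gamma> x \<in> Pts H"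
  using cover by (auto simp: is_cover_def geom_morphisms_def)

lemma cover_line: "L \<in> Lns G \<Longrightarrow> snd \<gamma> L \<in> Lns H"
  using cover by (auto simp: is_cover_def geom_morphisms_def)

lemma cover_Inc:
  "\<lbrakk>x \<in> Pts G; L \<in> Lns G; Inc G x L\<rbrakk> \<Longrightarrow> Inc H (fst \<gamma> x) (snd \<gamma> L)"
  using cover by (auto simp: is_cover_def geom_morphisms_def)

lemma cover_points_on: "L \<in> Lns G \<Longrightarrow> points_on H (snd \<gamma> L) = fst \<gamma> ` points_on G L"
  using cover by (auto simp: is_cover_def bij_betw_def)

lemma cover_point_eq:
  assumes "L \<in> Lns G" "x \<in> Pts G" "y \<in> Pts G" "Inc G x L" "Inc G y L" "fst \<gamma> x = fst \<gamma> y"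
  shows "x = y"
proof -
  have "inj_on (fst \<gamma>) (points_on G L)"
    using cover assms(1) by (auto simp: is_cover_def bij_betw_def)
  then show ?thesis
    using assms by (auto simp: inj_on_def points_on_def)
qed

lemma cover_line_eq:
  assumes "x \<in> Pts G" "L \<in> Lns G" "M \<in> Lns G" "Inc G x L" "Inc G x M" "snd \<gamma> L = snd \<gamma> M"
  shows "L = M"
proof -
  have "inj_on (snd \<gamma>) (lines_on G x)"
    using cover assms(1) by (auto simp: is_cover_def bij_betw_def)
  then show ?thesis
    using assms by (auto simp: inj_on_def lines_on_def)
qed

lemma cover_lift_line:
  assumes "x \<in> Pts G" "R \<in> Lns H" "Inc H (fst \<gamma> x) R"
  obtains L where "L \<in> Lns G" "Inc G x L" "snd \<gamma> L = R"
proof -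
  have "snd \<gamma> ` lines_on G x = lines_on H (fst \<gamma> x)"
    using cover assms(1) by (auto simp: is_cover_def bij_betw_def)
  then have "R \<in> snd \<gamma> ` lines_on G x"
    using assms by (auto simp: lines_on_def)
  then show thesis
    using that by (auto simp: lines_on_def)
qed

lemma cover_lift_point:
  assumes "L \<in> Lns G" "q \<in> Pts H" "Inc H q (snd \<gamma> L)"
  obtains y where "y \<in> Pts G" "Inc G y L" "fst \<gamma> y = q"
proof -
  have "q \<in> fst \<gamma> ` points_on G L"
    using assms cover_points_on[of L] by (auto simp: points_on_def)
  then show thesis
    using that by (auto simp: points_on_def)
qed

lemma cover_two_path: "two_path G x y \<Longrightarrow> two_path H (fst \<gamma> x) (fst \<gamma> y)"
  unfolding two_path_def using cover_point cover_line cover_Inc by blast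

text \<open>Local surjectivity is used alternately: \<open>R\<close> lifts through \<open>x\<close>,
  then \<open>p\<close> onto that line, \<open>R'\<close> through the new point, and
  \<open>q\<close> onto the last line. The start is prescribed, whereas the end is only some point
  over \<open>q\<close>.\<close>

lemma cover_lift_two_path:
  assumes "x \<in> Pts G" "two_path H (fst \<gamma> x) q"
  obtains y where "two_path G x y" "fst \<gamma> y = q"
proof -
  obtain R R' p where R: "R \<in> Lns H" "R' \<in> Lns H" "p \<in> Pts H" "q \<in> Pts H"
    "Inc H (fst \<gamma> x) R" "Inc H p R" "Inc H p R'" "Inc H q R'"
    using assms(2) unfolding two_path_def by blast
  obtain L where L: "L \<in> Lns G" "Inc G x L" "snd \<gamma> L = R"
    using cover_lift_line assms(1) R by blast
  obtain z where z: "z \<in> Pts G" "Inc G z L" "fst \<gamma> z = p"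
    using cover_lift_point L R by blast
  obtain M where M: "M \<in> Lns G" "Inc G z M" "snd \<gamma> M = R'"
    using cover_lift_line z R by blast
  obtain y where "y \<in> Pts G" "Inc G y M" "fst \<gamma> y = q"
    using cover_lift_point M R by blast
  then show thesis
    using that L z M assms(1) unfolding two_path_def by blast
qed

text \<open>If the middle point \<open>z\<close> has the same image as the ends, injectivity along
  each line collapses the path. Otherwise the images of \<open>L\<close> and \<open>M\<close> share
  two distinct points, so they agree; injectivity at \<open>z\<close> gives \<open>L = M\<close>,
  and injectivity along this line gives \<open>x = y\<close>.\<close>

lemma cover_inj_two_path:
  assumes "partial_linear H" "two_path G x y" "fst \<gamma> x = fst \<gamma> y"
  shows "x = y"
proof -
  obtain L M z where *: "L \<in> Lns G" "M \<in> Lns G" "z \<in> Pts G" "x \<in> Pts G" "y \<in> Pts G"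
    "Inc G x L" "Inc G z L" "Inc G z M" "Inc G y M"
    using assms(2) unfolding two_path_def by blast
  show ?thesis
  proof (cases "fst \<gamma> z = fst \<gamma> x")
    case True
    then have "z = x" "z = y"
      using * assms(3) cover_point_eq[of L z x] cover_point_eq[of M z y] by auto
    then show ?thesis
      by simp
  next
    case False
    have "snd \<gamma> L = snd \<gamma> M"
    proof (rule partial_linearD[OF assms(1), of "fst \<gamma> z" "fst \<gamma> x"])
      show "Inc H (fst \<gamma> x) (snd \<gamma> M)"
        using * assms(3) cover_Inc[of y M] by simp
    qed (use * False cover_point cover_line cover_Inc in auto)
    then have "L = M"
      using * cover_line_eq by blast
    then show ?thesis
      using * assms(3) cover_point_eq by blast
  qed
qed

text \<open>A path from the image of any base point to \<open>q\<close> lifts to a path that ends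
  over \<open>q\<close>.\<close>

lemma cover_surj_points:
  assumes "Pts G \<noteq> {}" "\<And>p q. \<lbrakk>p \<in> Pts H; q \<in> Pts H; p \<noteq> q\<rbrakk> \<Longrightarrow> two_path H p q"
  shows "fst \<gamma> ` Pts G = Pts H"
proof (intro equalityI subsetI)
  fix q assume q: "q \<in> Pts H"
  obtain x where x: "x \<in> Pts G"
    using assms(1) by blast
  show "q \<in> fst \<gamma> ` Pts G"
  proof (cases "fst \<gamma> x = q")
    case False
    then obtain y where "two_path G x y" "fst \<gamma> y = q"
      using cover_lift_two_path[OF x assms(2)[OF cover_point[OF x] q]] by blast
    then show ?thesis
      unfolding two_path_def by blast
  qed (use x in blast)
qed (use cover_point in blast)

lemma cover_surj_lines:
  assumes "fst \<gamma> ` Pts G = Pts H" "\<And>R. R \<in> Lns H \<Longrightarrow> points_on H R \<noteq> {}"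
  shows "snd \<gamma> ` Lns G = Lns H"
proof (intro equalityI subsetI)
  fix R assume R: "R \<in> Lns H"
  then obtain q where q: "q \<in> points_on H R"
    using assms(2) by blast
  then have "q \<in> fst \<gamma> ` Pts G"
    using assms(1) by (simp add: points_on_def)
  then obtain x where x: "x \<in> Pts G" "q = fst \<gamma> x"
    by blast
  then have "Inc H (fst \<gamma> x) R"
    using q by (simp add: points_on_def)
  then obtain L where "L \<in> Lns G" "snd \<gamma> L = R"
    by (rule cover_lift_line[OF x(1) R])
  then show "R \<in> snd \<gamma> ` Lns G"
    by blast
qed (use cover_line in blast)

end

section \<open>Factoring one cover through another\<close>

text \<open>Surjectivity of \<open>\<kappa>\<close> forces \<open>\<theta>\<close> on every point
  and line, which gives uniqueness; constancy of \<open>\<kappa>'\<close> on the fibres of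
  \<open>\<kappa>\<close> makes \<open>\<theta>\<close> well defined. For lines this constancy
  follows from that for points, as a line of \<open>H\<close> is determined by its points.\<close>

lemma cover_same_fibres_factor:
  assumes c1: "is_cover G H \<kappa>" and c2: "is_cover G H \<kappa>'"
    and surjP: "fst \<kappa> ` Pts G = Pts H" and surjL: "snd \<kappa> ` Lns G = Lns H"
    and lines: "inj_on (points_on H) (Lns H)"
    and fibres: "\<And>x y. \<lbrakk>x \<in> Pts G; y \<in> Pts G; fst \<kappa> x = fst \<kappa> y\<rbrakk> \<Longrightarrow> fst \<kappa>' x = fst \<kappa>' y"
  shows "\<exists>!\<theta>. \<theta> \<in> geom_morphisms H H \<and> comp_morphism G \<theta> \<kappa> = \<kappa>'"
proof (rule ex_ex1I)
  have fibresL: "snd \<kappa>' L = snd \<kappa>' M"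
    if L: "L \<in> Lns G" and M: "M \<in> Lns G" and eq: "snd \<kappa> L = snd \<kappa> M" for L M
  proof -
    \<comment> \<open>Here \<open>L\<close> and \<open>M\<close> are bound anew, so that the
      inclusion can be used in both directions.\<close>
    have sub: "fst \<kappa>' ` points_on G L \<subseteq> fst \<kappa>' ` points_on G M"
      if "fst \<kappa> ` points_on G L = fst \<kappa> ` points_on G M" for L M
    proof
      fix q assume "q \<in> fst \<kappa>' ` points_on G L"
      then obtain x where x: "x \<in> points_on G L" "q = fst \<kappa>' x"
        by blast
      then have "fst \<kappa> x \<in> fst \<kappa> ` points_on G M"
        using that by blast
      then obtain y where "y \<in> points_on G M" "fst \<kappa> x = fst \<kappa> y"
        by blast
      then show "q \<in> fst \<kappa>' ` points_on G M"
        using x fibres[of x y] by (auto simp: points_on_def)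
    qed
    have "fst \<kappa> ` points_on G L = fst \<kappa> ` points_on G M"
      using L M eq cover_points_on[OF c1] by metis
    then have "points_on H (snd \<kappa>' L) = points_on H (snd \<kappa>' M)"
      using L M sub cover_points_on[OF c2] by (metis subset_antisym)
    then show ?thesis
      using lines L M cover_line[OF c2] by (auto dest: inj_onD)
  qed
  \<comment> \<open>Any preimage may be chosen, by \<open>fibres\<close> and \<open>fibresL\<close>;
    \<open>restrict\<close> supplies the extensionality demanded of morphisms.\<close>
  define f where "f = restrict (\<lambda>q. fst \<kappa>' (inv_into (Pts G) (fst \<kappa>) q)) (Pts H)"
  define g where "g = restrict (\<lambda>R. snd \<kappa>' (inv_into (Lns G) (snd \<kappa>) R)) (Lns H)"
  have f: "f (fst \<kappa> x) = fst \<kappa>' x" if "x \<in> Pts G" for x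
    using that fibres[of "inv_into (Pts G) (fst \<kappa>) (fst \<kappa> x)" x] cover_point[OF c1]
    by (simp add: f_def inv_into_into f_inv_into_f)
  have g: "g (snd \<kappa> L) = snd \<kappa>' L" if "L \<in> Lns G" for L
    using that fibresL[of "inv_into (Lns G) (snd \<kappa>) (snd \<kappa> L)" L] cover_line[OF c1]
    by (simp add: g_def inv_into_into f_inv_into_f)
  have "f q \<in> Pts H" if "q \<in> Pts H" for q
    using that f cover_point[OF c2] unfolding surjP[symmetric] by auto
  moreover have "g R \<in> Lns H" if "R \<in> Lns H" for R
    using that g cover_line[OF c2] unfolding surjL[symmetric] by auto
  \<comment> \<open>An arbitrary preimage of \<open>R\<close> may miss the chosen \<open>x\<close>
    over \<open>q\<close>; the incident pair is therefore lifted by taking the line over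
    \<open>R\<close> through \<open>x\<close>.\<close>
  moreover have "Inc H (f q) (g R)" if q: "q \<in> Pts H" and R: "R \<in> Lns H" "Inc H q R" for q R
  proof -
    obtain x where x: "x \<in> Pts G" "q = fst \<kappa> x"
      using q unfolding surjP[symmetric] by blast
    obtain L where L: "L \<in> Lns G" "Inc G x L" "snd \<kappa> L = R"
      by (rule cover_lift_line[OF c1 x(1) R(1)]) (use R x in auto)
    then show ?thesis
      using f[OF x(1)] g[OF L(1)] cover_Inc[OF c2 x(1) L(1,2)] x by simp
  qed
  ultimately have mor: "(f, g) \<in> geom_morphisms H H"
    by (auto simp: geom_morphisms_def f_def g_def)
  have "fst \<kappa>' \<in> extensional (Pts G)" "snd \<kappa>' \<in> extensional (Lns G)"
    using c2 by (auto simp: is_cover_def geom_morphisms_def PiE_iff)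
  then have "compose (Pts G) f (fst \<kappa>) = fst \<kappa>'" "compose (Lns G) g (snd \<kappa>) = snd \<kappa>'"
    using extensionalityI[of _ "Pts G" "fst \<kappa>'"] extensionalityI[of _ "Lns G" "snd \<kappa>'"]
    by (auto simp: compose_def f g)
  then have "comp_morphism G (f, g) \<kappa> = \<kappa>'"
    by (simp add: comp_morphism_def)
  with mor show "\<exists>\<theta>. \<theta> \<in> geom_morphisms H H \<and> comp_morphism G \<theta> \<kappa> = \<kappa>'"
    by blast
next
  fix \<theta> \<theta>'
  assume "\<theta> \<in> geom_morphisms H H \<and> comp_morphism G \<theta> \<kappa> = \<kappa>'"
    and "\<theta>' \<in> geom_morphisms H H \<and> comp_morphism G \<theta>' \<kappa> = \<kappa>'"
  then have mor: "\<theta> \<in> geom_morphisms H H" "\<theta>' \<in> geom_morphisms H H"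
    and eq: "comp_morphism G \<theta> \<kappa> = comp_morphism G \<theta>' \<kappa>"
    by auto
  have ext: "fst \<theta> \<in> extensional (Pts H)" "fst \<theta>' \<in> extensional (Pts H)"
    "snd \<theta> \<in> extensional (Lns H)" "snd \<theta>' \<in> extensional (Lns H)"
    using mor by (auto simp: geom_morphisms_def PiE_iff)
  have "fst \<theta> (fst \<kappa> x) = fst \<theta>' (fst \<kappa> x)" if "x \<in> Pts G" for x
    using fun_cong[OF arg_cong[OF eq, of fst], of x] that
    by (simp add: comp_morphism_def compose_def)
  then have "fst \<theta> = fst \<theta>'"
    \<comment> \<open>Writing \<open>Pts H\<close> as the image of \<open>Pts G\<close> reduces
      equality to points of the form \<open>fst \<kappa> x\<close>.\<close>
    by (intro extensionalityI[OF ext(1,2)[folded surjP]]) auto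
  moreover have "snd \<theta> (snd \<kappa> L) = snd \<theta>' (snd \<kappa> L)" if "L \<in> Lns G" for L
    using fun_cong[OF arg_cong[OF eq, of snd], of L] that
    by (simp add: comp_morphism_def compose_def)
  then have "snd \<theta> = snd \<theta>'"
    by (intro extensionalityI[OF ext(3,4)[folded surjL]]) auto
  ultimately show "\<theta> = \<theta>'"
    by (simp add: prod_eqI)
qed

section \<open>Comparing the fibres of two covers\<close>

text \<open>Two lines through \<open>p\<close> and \<open>q\<close> lift to lines through one
  \<open>x\<close> over \<open>p\<close>, carrying points \<open>y\<close> and \<open>y'\<close>
  over \<open>q\<close>. The path from \<open>y\<close> via \<open>x\<close> to \<open>y'\<close>
  forces \<open>y = y'\<close>, so the claim descends from \<open>G\<close>.\<close>

lemma cover_partial_linear: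
  assumes cover: "is_cover G H \<gamma>" and surj: "fst \<gamma> ` Pts G = Pts H" and lin: "partial_linear G"
    and sep: "\<And>x y. \<lbrakk>two_path G x y; fst \<gamma> x = fst \<gamma> y\<rbrakk> \<Longrightarrow> x = y"
  shows "partial_linear H"
  unfolding partial_linear_def
proof (intro ballI impI)
  fix p q R R'
  assume p: "p \<in> Pts H" and q: "q \<in> Pts H" and R: "R \<in> Lns H" "R' \<in> Lns H"
    and inc: "Inc H p R \<and> Inc H q R \<and> Inc H p R' \<and> Inc H q R'"
  obtain x where x: "x \<in> Pts G" "fst \<gamma> x = p"
    using p unfolding surj[symmetric] by blast
  obtain L where L: "L \<in> Lns G" "Inc G x L" "snd \<gamma> L = R"
    by (rule cover_lift_line[OF cover x(1) R(1)]) (use inc x in auto)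
  obtain L' where L': "L' \<in> Lns G" "Inc G x L'" "snd \<gamma> L' = R'"
    by (rule cover_lift_line[OF cover x(1) R(2)]) (use inc x in auto)
  obtain y where y: "y \<in> Pts G" "Inc G y L" "fst \<gamma> y = q"
    by (rule cover_lift_point[OF cover L(1) q]) (use inc L in auto)
  obtain y' where y': "y' \<in> Pts G" "Inc G y' L'" "fst \<gamma> y' = q"
    by (rule cover_lift_point[OF cover L'(1) q]) (use inc L' in auto)
  have "two_path G y y'"
    unfolding two_path_def using x L L' y y' by blast
  then have "y = y'"
    by (rule sep) (use y y' in simp)
  then show "p = q \<or> R = R'"
    using partial_linearD[OF lin, of x y L L'] x L L' y y' by blast
qed

theorem covers_same_fibres:
  assumes cover: "is_cover G H \<gamma>" and surj: "fst \<gamma> ` Pts G = Pts H" and lin: "partial_linear G"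
    and sep: "\<And>x y. \<lbrakk>two_path G x y; fst \<gamma> x = fst \<gamma> y\<rbrakk> \<Longrightarrow> x = y"
    and join: "\<And>x y. \<lbrakk>x \<in> Pts G; y \<in> Pts G; fst \<gamma> x \<noteq> fst \<gamma> y\<rbrakk> \<Longrightarrow> two_path G x y"
    and \<kappa>: "is_cover G H \<kappa>" and x: "x \<in> Pts G" and y: "y \<in> Pts G"
  shows "fst \<kappa> x = fst \<kappa> y \<longleftrightarrow> fst \<gamma> x = fst \<gamma> y"
proof -
  have linH: "partial_linear H"
    using cover_partial_linear[OF cover surj lin sep] .
  \<comment> \<open>Points with different \<open>\<gamma>\<close>-images are joined by a path, along
    which \<open>\<kappa>\<close> separates distinct points.\<close>
  have coarser: "fst \<gamma> x = fst \<gamma> y"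
    if "x \<in> Pts G" "y \<in> Pts G" "fst \<kappa> x = fst \<kappa> y" for x y
  proof (rule ccontr)
    assume neq: "fst \<gamma> x \<noteq> fst \<gamma> y"
    then have "x = y"
      using that join by (intro cover_inj_two_path[OF \<kappa> linH]) auto
    then show False
      using neq by simp
  qed
  have "fst \<kappa> x = fst \<kappa> y" if eq: "fst \<gamma> x = fst \<gamma> y"
  proof (rule ccontr)
    assume neq: "fst \<kappa> x \<noteq> fst \<kappa> y"
    \<comment> \<open>These \<open>\<gamma>\<close>-preimages are auxiliary: projecting a path
      between them by \<open>\<gamma>\<close> joins \<open>fst \<kappa> x\<close> to
      \<open>fst \<kappa> y\<close> in \<open>H\<close>, and that path is then lifted along
      \<open>\<kappa>\<close> instead.\<close>
    obtain a b where ab: "a \<in> Pts G" "b \<in> Pts G" "fst \<gamma> a = fst \<kappa> x" "fst \<gamma> b = fst \<kappa> y"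
    proof -
      have "fst \<kappa> x \<in> fst \<gamma> ` Pts G" "fst \<kappa> y \<in> fst \<gamma> ` Pts G"
        using surj cover_point[OF \<kappa>] x y by auto
      then show thesis
        using that by auto
    qed
    then have "two_path H (fst \<gamma> a) (fst \<gamma> b)"
      using neq join by (intro cover_two_path[OF cover]) auto
    then have "two_path H (fst \<kappa> x) (fst \<kappa> y)"
      using ab by simp
    then obtain y' where y': "two_path G x y'" "fst \<kappa> y' = fst \<kappa> y"
      by (rule cover_lift_two_path[OF \<kappa> x])
    \<comment> \<open>Now \<open>x\<close>, \<open>y\<close> and \<open>y'\<close> have one
      \<open>\<gamma>\<close>-image, while \<open>x\<close> and \<open>y'\<close> are joined by a
      path; \<open>sep\<close> identifies them.\<close>
    then have "fst \<gamma> y' = fst \<gamma> y"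
      using coarser y unfolding two_path_def by blast
    then have "x = y'"
      using eq by (intro sep[OF y'(1)]) simp
    then show False
      using y' neq by simp
  qed
  then show ?thesis
    using coarser x y by blast
qed

section \<open>The affine quadrangle\<close>

lemma gen_quadrangle_projection_ex:
  assumes "gen_quadrangle S s t" "x \<in> Pts S" "L \<in> Lns S" "\<not> Inc S x L"
  obtains y M where "y \<in> Pts S" "M \<in> Lns S" "Inc S x M" "Inc S y M" "Inc S y L"
proof -
  have "\<exists>yM. case yM of (y, M) \<Rightarrow>
      y \<in> Pts S \<and> M \<in> Lns S \<and> Inc S x M \<and> Inc S y M \<and> Inc S y L"
    using assms unfolding gen_quadrangle_def by blast
  then show thesis
    using that by auto
qed

lemma gen_quadrangle_projection_unique:
  assumes "gen_quadrangle S s t" "x \<in> Pts S" "L \<in> Lns S" "\<not> Inc S x L"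
    and "y \<in> Pts S" "M \<in> Lns S" "Inc S x M" "Inc S y M" "Inc S y L"
    and "z \<in> Pts S" "N \<in> Lns S" "Inc S x N" "Inc S z N" "Inc S z L"
  shows "y = z"
proof -
  let ?P = "\<lambda>yM. case yM of (y, M) \<Rightarrow>
    y \<in> Pts S \<and> M \<in> Lns S \<and> Inc S x M \<and> Inc S y M \<and> Inc S y L"
  have "\<forall>x \<in> Pts S. \<forall>L \<in> Lns S. \<not> Inc S x L \<longrightarrow>
      (\<exists>!yM. case yM of (y, M) \<Rightarrow>
         y \<in> Pts S \<and> M \<in> Lns S \<and> Inc S x M \<and> Inc S y M \<and> Inc S y L)"
    using assms(1) unfolding gen_quadrangle_def by (elim conjE)
  from this[THEN bspec, OF assms(2), THEN bspec, OF assms(3), THEN mp, OF assms(4)]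
  have ex1: "\<exists>!yM. ?P yM" .
  have "?P (y, M)" "?P (z, N)"
    using assms(5-) by simp_all
  then have "(y, M) = (z, N)"
    by (rule trans[OF the1_equality[OF ex1, symmetric] the1_equality[OF ex1]])
  then show ?thesis
    by simp
qed

lemma gen_quadrangle_partial_linear: "gen_quadrangle S s t \<Longrightarrow> partial_linear S"
  unfolding gen_quadrangle_def partial_linear_def lines_on_def by blast

text \<open>The disjoint sum representing \<open>s +c cone\<close> embeds into the points of
  \<open>L\<close>. An element \<open>u\<close> of \<open>Field s\<close>, which exists as
  \<open>ctwo \<le>o s\<close>, and the element of \<open>cone\<close> give two distinct
  images.\<close>

lemma thick_gen_quadrangle_two_points:
  fixes s :: "'a rel"
  assumes "thick_gen_quadrangle S s t" "L \<in> Lns S"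
  obtains x y where "x \<in> points_on S L" "y \<in> points_on S L" "x \<noteq> y"
proof -
  have "ctwo \<le>o s"
    using assms(1) by (simp add: thick_gen_quadrangle_def)
  then have "|UNIV :: bool set| \<le>o |Field s|"
    using card_of_mono2[of ctwo s] by (simp add: ctwo_def Field_card_of)
  then obtain e :: "bool \<Rightarrow> 'a" where "e ` UNIV \<subseteq> Field s"
    unfolding card_of_ordLeq[symmetric] by blast
  then obtain u where u: "u \<in> Field s"
    by blast
  have "s +c cone =o |points_on S L|"
    using assms ordIso_symmetric by (auto simp: thick_gen_quadrangle_def gen_quadrangle_def)
  then have "|Field s <+> Field cone| \<le>o |points_on S L|"
    unfolding csum_def by (rule ordIso_imp_ordLeq)
  then obtain h where h: "inj_on h (Field s <+> Field cone)"
      "h ` (Field s <+> Field cone) \<subseteq> points_on S L"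
    unfolding card_of_ordLeq[symmetric] by blast
  have "Inl u \<in> Field s <+> Field cone" "Inr () \<in> Field s <+> Field cone"
    using u by (auto simp: cone_def Field_card_of)
  then show thesis
    using h that[of "h (Inl u)" "h (Inr ())"] by (auto dest: inj_onD)
qed

section \<open>The complement of a full geometrical hyperplane\<close>

locale quadrangle_hyperplane =
  fixes S S' :: "('p, 'l) geometry" and s :: "'a rel" and t :: "'b rel"
  assumes thick: "thick_gen_quadrangle S s t"
    and sub: "subgeometry S' S"
    and full: "full_in S' S"
    and hyperplane: "geometrical_hyperplane S' S"
begin

abbreviation "A \<equiv> affine_quadrangle S S'"
abbreviation "E \<equiv> ovoid_geometry S S'"

lemma gq: "gen_quadrangle S s t"
  using thick by (simp add: thick_gen_quadrangle_def)

lemma affine_simps [simp]: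
  "Pts A = Pts S - Pts S'" "Lns A = Lns S - Lns S'" "Inc A = Inc S"
  by (simp_all add: affine_quadrangle_def)

text \<open>Fullness keeps every line through the affine point \<open>x\<close> out of
  \<open>S'\<close>, and \<open>z = x\<close> is impossible for \<open>z\<close> in
  \<open>S'\<close>.\<close>

lemma mem_subtended_ovoid:
  assumes "x \<in> Pts A"
  shows "z \<in> subtended_ovoid S S' x \<longleftrightarrow> z \<in> Pts S' \<and> (\<exists>L \<in> Lns A. Inc S z L \<and> Inc S x L)"
proof -
  have "L \<notin> Lns S'" if "L \<in> Lns S" "Inc S x L" for L
    using full that assms by (auto simp: full_in_def points_on_def)
  then show ?thesis
    using assms sub
    by (auto simp: subtended_ovoid_def perp_def collinear_def subgeometry_def)
qed

lemma affine_line_hyperplane_point: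
  assumes "L \<in> Lns A"
  shows "\<exists>!z. z \<in> Pts S' \<and> Inc S z L"
  using assms hyperplane sub
  by (auto simp: geometrical_hyperplane_def points_on_def subgeometry_def)

text \<open>Of at least two points of \<open>L\<close> in \<open>S\<close>, only one can lie in
  \<open>S'\<close>.\<close>

lemma affine_line_nonempty:
  assumes "L \<in> Lns A"
  shows "points_on A L \<noteq> {}"
proof -
  have "L \<in> Lns S"
    using assms by simp
  then obtain x y where "x \<in> points_on S L" "y \<in> points_on S L" "x \<noteq> y"
    by (rule thick_gen_quadrangle_two_points[OF thick])
  then show ?thesis
    using affine_line_hyperplane_point[OF assms] by (auto simp: points_on_def)
qed

lemma affine_partial_linear: "partial_linear A"
  using gen_quadrangle_partial_linear[OF gq] by (auto simp: partial_linear_def)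

text \<open>Let \<open>z\<close> lie in the first ovoid only, and project \<open>y\<close> onto the
  line \<open>L\<close> joining \<open>x\<close> and \<open>z\<close>. The projection
  \<open>w\<close> differs from \<open>z\<close>, since \<open>y\<close> is not collinear with
  \<open>z\<close>; hence \<open>w\<close> is affine and serves as the middle point.\<close>

lemma two_path_if_subtended_ovoid_not_subset:
  assumes x: "x \<in> Pts A" and y: "y \<in> Pts A"
    and nsub: "\<not> subtended_ovoid S S' x \<subseteq> subtended_ovoid S S' y"
  shows "two_path A x y"
proof -
  obtain z where z: "z \<in> subtended_ovoid S S' x" "z \<notin> subtended_ovoid S S' y"
    using nsub by blast
  then obtain L where L: "L \<in> Lns A" "Inc S z L" "Inc S x L" "z \<in> Pts S'"
    using mem_subtended_ovoid[OF x] by blast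
  show ?thesis
  proof (cases "Inc S y L")
    case True
    then show ?thesis
      using x y L unfolding two_path_def affine_simps by blast
  next
    case False
    then obtain w M where w: "w \<in> Pts S" "M \<in> Lns S" "Inc S y M" "Inc S w M" "Inc S w L"
      using gen_quadrangle_projection_ex[OF gq, of y L] y L by auto
    have M: "M \<in> Lns A"
      using full w y by (auto simp: full_in_def points_on_def)
    have "w \<notin> Pts S'"
    proof
      assume "w \<in> Pts S'"
      then have "w = z"
        using affine_line_hyperplane_point[OF L(1)] L w by blast
      then show False
        using z L M w mem_subtended_ovoid[OF y] by blast
    qed
    then show ?thesis
      using x y L w M unfolding two_path_def affine_simps by blast
  qed
qed

lemma two_path_if_subtended_ovoid_neq:
  assumes "x \<in> Pts A" "y \<in> Pts A" "subtended_ovoid S S' x \<noteq> subtended_ovoid S S' y"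
  shows "two_path A x y"
proof (cases "subtended_ovoid S S' x \<subseteq> subtended_ovoid S S' y")
  case True
  then have "two_path A y x"
    using assms two_path_if_subtended_ovoid_not_subset[of y x] by blast
  then show ?thesis
    unfolding two_path_def by blast
qed (use assms two_path_if_subtended_ovoid_not_subset in blast)

text \<open>The point \<open>l\<close> of \<open>L\<close> in the hyperplane lies in the ovoid of
  \<open>x\<close>, hence in that of \<open>y\<close>. If \<open>y\<close> were off
  \<open>L\<close>, both \<open>l\<close> and the affine point \<open>z\<close> would be its
  projection onto \<open>L\<close>.\<close>

lemma two_path_same_ovoid_collinear:
  assumes "two_path A x y" "subtended_ovoid S S' x = subtended_ovoid S S' y"
  obtains L where "L \<in> Lns A" "Inc S x L" "Inc S y L"
proof -
  obtain L M z where *: "L \<in> Lns A" "M \<in> Lns A" "z \<in> Pts A" "x \<in> Pts A" "y \<in> Pts A"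
    "Inc S x L" "Inc S z L" "Inc S z M" "Inc S y M"
    using assms(1) unfolding two_path_def affine_simps by blast
  obtain l where l: "l \<in> Pts S'" "Inc S l L"
    using affine_line_hyperplane_point[OF *(1)] by blast
  then have "l \<in> subtended_ovoid S S' y"
    using * mem_subtended_ovoid[of x l] assms(2) by blast
  then obtain N where N: "N \<in> Lns A" "Inc S l N" "Inc S y N"
    using mem_subtended_ovoid[of y l] * by blast
  have "Inc S y L"
  proof (rule ccontr)
    assume "\<not> Inc S y L"
    moreover have "l \<in> Pts S"
      using l sub unfolding subgeometry_def by blast
    ultimately have "z = l"
      using * l N gen_quadrangle_projection_unique[OF gq, of y L z M l N] by simp
    then show False
      using * l by simp
  qed
  then show thesis
    using that * by blast
qed

text \<open>Incidence in \<open>E\<close> is membership and rosettes consist of subtended ovoids, so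
  a line of \<open>E\<close> is its own point set.\<close>

lemma rosette_eq_points_on:
  assumes "R \<in> Lns E"
  shows "points_on E R = R"
proof -
  obtain L where "R = rosette S S' L"
    using assms unfolding ovoid_geometry_def by auto
  then have "R \<subseteq> subtended_ovoid S S' ` Pts A"
    unfolding rosette_def points_on_def by blast
  then show ?thesis
    unfolding points_on_def ovoid_geometry_def geometry.simps by blast
qed

lemma ovoid_line_nonempty:
  assumes "R \<in> Lns E"
  shows "points_on E R \<noteq> {}"
proof -
  obtain L where "L \<in> Lns A" "R = rosette S S' L"
    using assms unfolding ovoid_geometry_def by auto
  then show ?thesis
    using affine_line_nonempty[of L] rosette_eq_points_on[OF assms] by (simp add: rosette_def)
qed

lemma ovoid_lines_inj: "inj_on (points_on E) (Lns E)"
  by (rule inj_onI) (simp add: rosette_eq_points_on)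

section \<open>Covers of the ovoid geometry when the natural projection is a cover\<close>

context
  assumes projection: "is_cover A E (natural_projection S S')"
begin

lemma projection_point: "x \<in> Pts A \<Longrightarrow> fst (natural_projection S S') x = subtended_ovoid S S' x"
  by (simp add: natural_projection_def)

lemma projection_surj: "fst (natural_projection S S') ` Pts A = Pts E"
  by (simp add: natural_projection_def ovoid_geometry_def)

text \<open>Joined points with the same ovoid are collinear, and a cover is injective along a
  line.\<close>

lemma projection_inj_two_path:
  assumes path: "two_path A x y"
    and eq: "fst (natural_projection S S') x = fst (natural_projection S S') y"
  shows "x = y"
proof -
  have xy: "x \<in> Pts A" "y \<in> Pts A"
    using path unfolding two_path_def by auto
  have "subtended_ovoid S S' x = subtended_ovoid S S' y"
    using eq unfolding projection_point[OF xy(1)] projection_point[OF xy(2)] .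
  then obtain L where "L \<in> Lns A" "Inc S x L" "Inc S y L"
    by (rule two_path_same_ovoid_collinear[OF path])
  then show ?thesis
    using cover_point_eq[OF projection _ xy _ _ eq, of L] by simp
qed

lemma two_path_if_projection_neq:
  assumes "x \<in> Pts A" "y \<in> Pts A"
    and "fst (natural_projection S S') x \<noteq> fst (natural_projection S S') y"
  shows "two_path A x y"
  using assms(3) unfolding projection_point[OF assms(1)] projection_point[OF assms(2)]
  by (rule two_path_if_subtended_ovoid_neq[OF assms(1,2)])

lemma ovoid_geometry_two_path:
  assumes "p \<in> Pts E" "q \<in> Pts E" "p \<noteq> q"
  shows "two_path E p q"
proof -
  obtain x where x: "x \<in> Pts A" "p = fst (natural_projection S S') x"
    using assms(1) unfolding projection_surj[symmetric] by (rule imageE)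
  obtain y where y: "y \<in> Pts A" "q = fst (natural_projection S S') y"
    using assms(2) unfolding projection_surj[symmetric] by (rule imageE)
  show ?thesis
    using assms(3) unfolding x(2) y(2)
    by (intro cover_two_path[OF projection] two_path_if_projection_neq[OF x(1) y(1)])
qed

text \<open>Both covers have the fibres of the natural projection, hence the same fibres as each
  other, and \<open>\<kappa>\<close> is onto; so \<open>\<kappa>'\<close> factors uniquely through
  \<open>\<kappa>\<close>.\<close>

lemma unique_cover_morphism:
  assumes \<kappa>: "is_cover A E \<kappa>" and \<kappa>': "is_cover A E \<kappa>'"
  shows "\<exists>!\<theta>. \<theta> \<in> geom_morphisms E E \<and> comp_morphism A \<theta> \<kappa> = \<kappa>'"
proof (rule cover_same_fibres_factor[OF \<kappa> \<kappa>' _ _ ovoid_lines_inj])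
  have nonempty: "\<not> (Pts A = {} \<and> Lns A = {})"
    using projection unfolding is_cover_def by (elim conjE)
  \<comment> \<open>The definition of a cover only excludes that points and lines are both absent;
    but a line of \<open>A\<close> would carry an affine point.\<close>
  have "Pts A \<noteq> {}"
  proof
    assume empty: "Pts A = {}"
    then obtain L where "L \<in> Lns A"
      using nonempty by blast
    then show False
      using affine_line_nonempty[of L] empty unfolding points_on_def by blast
  qed
  then show surj: "fst \<kappa> ` Pts A = Pts E"
    by (rule cover_surj_points[OF \<kappa> _ ovoid_geometry_two_path])
  show "snd \<kappa> ` Lns A = Lns E"
    by (rule cover_surj_lines[OF \<kappa> surj ovoid_line_nonempty])
  have fibres: "fst \<mu> x = fst \<mu> y \<longleftrightarrow>
      fst (natural_projection S S') x = fst (natural_projection S S') y"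
    if "is_cover A E \<mu>" "x \<in> Pts A" "y \<in> Pts A" for \<mu> x y
    by (rule covers_same_fibres[OF projection projection_surj affine_partial_linear _ _ that])
      (fact projection_inj_two_path two_path_if_projection_neq)+
  show "fst \<kappa>' x = fst \<kappa>' y" if "x \<in> Pts A" "y \<in> Pts A" "fst \<kappa> x = fst \<kappa> y" for x y
    using that(3) fibres[OF \<kappa> that(1,2)] fibres[OF \<kappa>' that(1,2)] by simp
qed

end

end

theorem corollary4p8:
  fixes S S' :: "('p, 'l) geometry"
    and s :: "'a rel" and t :: "'b rel" and s' :: "'c rel" and t' :: "'d rel"
  defines "A \<equiv> affine_quadrangle S S'"
    and "E \<equiv> ovoid_geometry S S'"
    and "\<pi> \<equiv> natural_projection S S'"
  assumes "thick_gen_quadrangle S s t"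
    and "thick_gen_quadrangle S' s' t'"
    and "subgeometry S' S"
    and "full_in S' S"
    and "geometrical_hyperplane S' S"
    and "is_cover A E \<pi>"
  shows "initial_object (cover_category A E) \<pi> \<and>
         (\<forall>\<kappa> \<in> Ob (cover_category A E). zero_object (cover_category A E) \<kappa>)"
proof -
  interpret quadrangle_hyperplane S S' s t
    using assms by unfold_locales
  have "\<exists>!\<theta>. \<theta> \<in> geom_morphisms E E \<and> comp_morphism A \<theta> \<kappa> = \<kappa>'"
    if "is_cover A E \<kappa>" "is_cover A E \<kappa>'" for \<kappa> \<kappa>'
    using that assms(9) unfolding A_def E_def \<pi>_def by (intro unique_cover_morphism)
  \<comment> \<open>Every hom-set between objects is a singleton, so each object is both initial and
    terminal; the assumed cover property makes \<open>\<pi>\<close> an object.\<close>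
  then show ?thesis
    using assms(9)
    by (simp add: zero_object_def initial_object_def terminal_object_def cover_category_def)
qed

end
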